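(* There are infinitely many square numbers $N$ for which there exist square numbers $u$ and $v$, neither of which is divisible by $10$, such that $N$ is constructed by putting $u$ and $v$ together, i.e. $N = u\cdot 10^{m} + v$, where $m$ is the number of decimal digits of $v$.
   Context: A square number is an integer of the form $n^2$ with $n$ a positive integer. A number $N$ is "constructed by putting two square numbers $u$ and $v$ together" if the decimal expansion of $N$ is the concatenation of the decimal expansion of $u$ followed by that of $v$, i.e. $N=u\cdot 10^{m}+v$, where $m$ is the number of decimal digits of $v$ (for example, $4$ and $9$ put together give $49$). *)

theory Defs
  imports Complex_Main "HOL-Library.Log_Nat"
begin

definition square_number :: "nat \<Rightarrow> bool" where
  "square_number N \<longleftrightarrow> (\<exists>n>0. N = n\<^sup>2)"

text \<open>
  For \<open>v > 0\<close>, \<open>floorlog 10 v\<close> is the number of decimal digits of \<open>v\<close>; it is \<open>0\<close> for \<open>v = 0\<close>,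
  which is not a square number in the above sense.
\<close>

definition put_together :: "nat \<Rightarrow> nat \<Rightarrow> nat" where
  "put_together u v = u * 10 ^ floorlog 10 v + v"

lemma put_together_4_9: "put_together 4 9 = 49"
  by (simp add: put_together_def compute_floorlog)

end

theory Submission
  imports Defs "HOL-Library.Infinite_Set"
begin

text \<open>
  Putting \<open>a\<^sup>2\<close> and \<open>b\<^sup>2\<close> together, where \<open>b\<^sup>2\<close> has \<open>2 * k\<close> digits, gives a square exactly when
  \<open>(a * 10 ^ k)\<^sup>2 + b\<^sup>2\<close> is a square, so one looks for Pythagorean triples in which one leg is
  divisible by \<open>10 ^ k\<close> while the other leg lies between \<open>10 ^ k / sqrt 10\<close> and \<open>10 ^ k\<close>.

  Two consecutive numbers \<open>s\<close> and \<open>s + 1\<close> generate the triple with legs \<open>2 * s * (s + 1)\<close> and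
  \<open>2 * s + 1\<close>.  For \<open>s + 1 = 2 ^ (k - 1)\<close>, \<open>k \<ge> 2\<close>, these legs are \<open>s * 2 ^ k\<close> and \<open>2 ^ k - 1\<close>, and scaling
  by \<open>5 ^ k\<close> turns them into \<open>s * 10 ^ k\<close> and \<open>b = 10 ^ k - 5 ^ k\<close>.  The second leg
  is at least three quarters of \<open>10 ^ k\<close> and less than \<open>10 ^ k\<close>, so its square has \<open>2 * k\<close> digits.  Both \<open>s\<close> and \<open>b\<close> are odd, so
  their squares are not divisible by \<open>10\<close>.  The smallest case, \<open>k = 2\<close>, puts \<open>1\<close> and
  \<open>75\<^sup>2 = 5625\<close> together to \<open>15625 = 125\<^sup>2\<close>.
\<close>

lemma consecutive_pythagorean_triple:
  fixes s f :: nat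
  shows "s\<^sup>2 * (f * (2 * (s + 1)))\<^sup>2 + (f * (2 * s + 1))\<^sup>2 = (f * ((s + 1)\<^sup>2 + s\<^sup>2))\<^sup>2"
  by (simp add: power2_eq_square algebra_simps)

text \<open>
  The lower bound \<open>3 / 4\<close> is a convenient number above \<open>1 / sqrt 10\<close>.
\<close>

lemma floorlog_10_power2:
  fixes b k :: nat
  assumes "3 * 10 ^ k \<le> 4 * b" and "b < 10 ^ k"
  shows "floorlog 10 (b\<^sup>2) = 2 * k"
proof (rule antisym)
  have "b\<^sup>2 < (10 ^ k)\<^sup>2"
    using assms(2) by (rule power_strict_mono) simp_all
  thus "floorlog 10 (b\<^sup>2) \<le> 2 * k"
    by (intro floorlog_leI) (simp_all add: power_even_eq)
  have "(3 * 10 ^ k)\<^sup>2 \<le> (4 * b)\<^sup>2"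
    using assms(1) by (rule power_mono) simp
  hence "10 ^ (2 * k) \<le> 10 * b\<^sup>2"
    by (simp add: power_mult_distrib power_even_eq)
  hence "10 ^ (2 * k - 1) \<le> b\<^sup>2"
    by (cases "2 * k") auto
  thus "2 * k \<le> floorlog 10 (b\<^sup>2)"
    by (rule floorlog_geI) simp
qed

lemma odd_square_not_10_dvd:
  fixes n :: nat
  assumes "odd n"
  shows "\<not> 10 dvd n\<^sup>2"
proof
  assume "10 dvd n\<^sup>2"
  hence "2 dvd n\<^sup>2"
    by (rule dvd_trans[rotated]) simp
  thus False
    using assms by simp
qed

text \<open>
  Scaling the consecutive-number triple by \<open>f\<close> makes its even leg equal to \<open>s * 10 ^ k\<close>.  The odd
  leg stays odd because \<open>f\<close> is odd: all factors \<open>2\<close> of \<open>10 ^ k\<close> come from \<open>2 * (s + 1)\<close>.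
\<close>

lemma put_together_squares_family:
  fixes s f k :: nat
  assumes "s > 0" and "odd s" and "odd f" and "10 ^ k = f * (2 * (s + 1))"
  defines "b \<equiv> f * (2 * s + 1)" and "c \<equiv> f * ((s + 1)\<^sup>2 + s\<^sup>2)"
  shows "put_together (s\<^sup>2) (b\<^sup>2) = c\<^sup>2" and "\<not> 10 dvd s\<^sup>2" and "\<not> 10 dvd b\<^sup>2"
proof -
  have "f > 0"
    using assms(3) by (rule odd_pos)
  \<comment> \<open>Since \<open>b / 10 ^ k = (2 * s + 1) / (2 * s + 2)\<close>, the quotient is at least \<open>3 / 4\<close>.\<close>
  have "f * (6 * (s + 1)) \<le> f * (4 * (2 * s + 1))"
    using assms(1) by (intro mult_le_mono2) simp
  hence "floorlog 10 (b\<^sup>2) = 2 * k"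
    using \<open>f > 0\<close> by (intro floorlog_10_power2) (simp_all add: assms(4) b_def algebra_simps)
  hence "put_together (s\<^sup>2) (b\<^sup>2) = s\<^sup>2 * (10 ^ k)\<^sup>2 + b\<^sup>2"
    by (simp add: put_together_def power_even_eq)
  thus "put_together (s\<^sup>2) (b\<^sup>2) = c\<^sup>2"
    unfolding assms(4) b_def c_def consecutive_pythagorean_triple .
  show "\<not> 10 dvd s\<^sup>2" "\<not> 10 dvd b\<^sup>2"
    using assms(2,3) by (simp_all add: odd_square_not_10_dvd b_def)
qed

theorem theorem2p1:
  shows "infinite {N. square_number N \<and>
           (\<exists>u v. square_number u \<and> square_number v \<and>
                  \<not> 10 dvd u \<and> \<not> 10 dvd v \<and> N = put_together u v)}"
  unfolding infinite_nat_iff_unbounded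
proof
  fix m :: nat
  \<comment> \<open>The member with \<open>k = j + 1\<close> exceeds \<open>5 ^ k\<close>, hence \<open>m\<close>; \<open>j \<ge> 1\<close> makes \<open>s\<close> odd.\<close>
  define j where "j = Suc m"
  define s :: nat where "s = 2 ^ j - 1"
  define f :: nat where "f = 5 ^ Suc j"
  define b where "b = f * (2 * s + 1)"
  define c where "c = f * ((s + 1)\<^sup>2 + s\<^sup>2)"
  have s: "s > 0" "odd s" and s1: "s + 1 = 2 ^ j"
    using one_less_power[of "2::nat" j] by (simp_all add: s_def j_def)
  have f: "odd f" "f > 0"
    by (simp_all add: f_def)
  have "(10::nat) ^ Suc j = (5 * 2) ^ Suc j"
    by simp
  also have "\<dots> = f * (2 * (s + 1))"
    unfolding power_mult_distrib f_def s1 by simp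
  finally have ten: "10 ^ Suc j = f * (2 * (s + 1))" .
  note family = put_together_squares_family[OF s f(1) ten, folded b_def c_def]
  have "m < 5 ^ m"
    by (rule power_gt_expt) simp
  also have "5 ^ m \<le> f"
    unfolding f_def j_def by (rule power_increasing) simp_all
  also have "f \<le> c"
    by (simp add: c_def power2_eq_square)
  also have "c \<le> c\<^sup>2"
    by (simp add: power2_eq_square)
  finally have "m < c\<^sup>2" .
  have "square_number (s\<^sup>2)" "square_number (b\<^sup>2)" "square_number (c\<^sup>2)"
    unfolding square_number_def using s(1) f by (auto simp: b_def c_def)
  with family have "c\<^sup>2 \<in> {N. square_number N \<and>
           (\<exists>u v. square_number u \<and> square_number v \<and>
                  \<not> 10 dvd u \<and> \<not> 10 dvd v \<and> N = put_together u v)}"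
    by fastforce
  with \<open>m < c\<^sup>2\<close> show "\<exists>n>m. n \<in> {N. square_number N \<and>
           (\<exists>u v. square_number u \<and> square_number v \<and>
                  \<not> 10 dvd u \<and> \<not> 10 dvd v \<and> N = put_together u v)}"
    by blast
qed

end
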